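(* Let $X$ be a Banach space and let $\mathcal{U}=\{U(t,s)\}_{t\ge s\ge 0}$ be a nonuniform exponentially bounded evolution family on $X$. If there exist $\alpha\in\mathcal{A}(\mathcal{U})$ and $p,K>0$ such that $$\int_t^\infty \varphi_\alpha^p(\xi,\Phi(t)u)\,d\xi\le K\,\varphi_\alpha^p(t,u)\quad\text{for all } t\ge 0 \text{ and } u\in\mathcal{C}_b(\mathcal{U},\alpha),$$ then $\mathcal{U}$ is nonuniform exponentially stable.
   Context: $X$ is a Banach space, $\mathcal{L}(X)$ is the algebra of bounded linear operators on $X$, and $\mathbb{R}_+=[0,\infty)$. $C(\mathbb{R}_+,X)$ is the space of all continuous functions $u:\mathbb{R}_+\to X$. An evolution family is a family $\mathcal{U}=\{U(t,s)\}_{t\ge s\ge 0}$ in $\mathcal{L}(X)$ such that $U(t,t)=\mathrm{Id}$ for $t\ge 0$; $U(t,\tau)U(\tau,s)=U(t,s)$ for $t\ge\tau\ge s\ge 0$; and for each $x\in X$ the map $(t,s)\mapsto U(t,s)x$ is continuous on $\{(t,s)\in\mathbb{R}_+^2: t\ge s\}$. A number $\alpha\in\mathbb{R}$ is an admissible exponent for $\mathcal{U}$ if there is a continuous function $M:\mathbb{R}_+\to(0,\infty)$ with $\|U(t,s)\|\le M(s)e^{\alpha(t-s)}$ for all $t\ge s\ge 0$. $\mathcal{A}(\mathcal{U})$ is the set of all admissible exponents. $\mathcal{U}$ is nonuniform exponentially bounded if $\mathcal{A}(\mathcal{U})\ne\emptyset$, and nonuniform exponentially stable if $\mathcal{A}(\mathcal{U})$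 contains a negative number. For $\alpha\in\mathcal{A}(\mathcal{U})$, $t\ge 0$, $u\in C(\mathbb{R}_+,X)$, set $\varphi_\alpha(t,u)=\sup_{\tau\ge t}e^{-\alpha(\tau-t)}\|U(\tau,t)u(t)\|$; the map $t\mapsto\varphi_\alpha(t,u)$ is known to be continuous on $\mathbb{R}_+$ for every $u\in C(\mathbb{R}_+,X)$. $\varphi_\alpha^p(t,u)$ means $(\varphi_\alpha(t,u))^p$. Let $\mathcal{C}_b(\mathcal{U},\alpha)=\{u\in C(\mathbb{R}_+,X):\sup_{t\ge 0}\varphi_\alpha(t,u)<\infty\}$. For $t\ge 0$ the operator $\Phi(t):C(\mathbb{R}_+,X)\to C(\mathbb{R}_+,X)$ is defined by $(\Phi(t)u)(\xi)=U(\xi,t)u(t)$ for $\xi\ge t$ and $(\Phi(t)u)(\xi)=u(\xi)$ for $0\le\xi<t$. *)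

theory Defs
  imports "HOL-Analysis.Analysis"
begin

text \<open>
  A family \<open>U\<close> indexed by \<open>t \<ge> s \<ge> 0\<close> is given as a function of two reals; a function on
  \<open>[0,\<infinity>)\<close> is given as a function on the reals. Values outside these domains are irrelevant.
\<close>

definition evolution_family :: "(real \<Rightarrow> real \<Rightarrow> 'a::banach \<Rightarrow>\<^sub>L 'a) \<Rightarrow> bool" where
  "evolution_family U \<longleftrightarrow>
     (\<forall>t\<ge>0. U t t = id_blinfun) \<and>
     (\<forall>t \<tau> s. 0 \<le> s \<and> s \<le> \<tau> \<and> \<tau> \<le> t \<longrightarrow> U t \<tau> o\<^sub>L U \<tau> s = U t s) \<and>
     (\<forall>x. continuous_on {(t, s). 0 \<le> s \<and> s \<le> t} (\<lambda>(t, s). U t s x))"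

definition admissible_exponents :: "(real \<Rightarrow> real \<Rightarrow> 'a::banach \<Rightarrow>\<^sub>L 'a) \<Rightarrow> real set" where
  "admissible_exponents U =
     {\<alpha>. \<exists>M :: real \<Rightarrow> real. continuous_on {0..} M \<and> (\<forall>s\<ge>0. M s > 0) \<and>
           (\<forall>t s. 0 \<le> s \<and> s \<le> t \<longrightarrow> norm (U t s) \<le> M s * exp (\<alpha> * (t - s)))}"

definition nonuniform_exp_bounded :: "(real \<Rightarrow> real \<Rightarrow> 'a::banach \<Rightarrow>\<^sub>L 'a) \<Rightarrow> bool" where
  "nonuniform_exp_bounded U \<longleftrightarrow> admissible_exponents U \<noteq> {}"

definition nonuniform_exp_stable :: "(real \<Rightarrow> real \<Rightarrow> 'a::banach \<Rightarrow>\<^sub>L 'a) \<Rightarrow> bool" where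
  "nonuniform_exp_stable U \<longleftrightarrow> (\<exists>\<alpha>\<in>admissible_exponents U. \<alpha> < 0)"

text \<open>
  The supremum is taken in the reals. For \<open>\<alpha>\<close> an admissible exponent with bound \<open>M\<close> and
  \<open>t \<ge> 0\<close> it is over a nonempty set bounded above by \<open>M t * norm (u t)\<close>; for other
  arguments the value is not meaningful.
\<close>

definition evol_phi ::
  "(real \<Rightarrow> real \<Rightarrow> 'a::banach \<Rightarrow>\<^sub>L 'a) \<Rightarrow> real \<Rightarrow> real \<Rightarrow> (real \<Rightarrow> 'a) \<Rightarrow> real" where
  "evol_phi U \<alpha> t u = (SUP \<tau>\<in>{t..}. exp (- \<alpha> * (\<tau> - t)) * norm (U \<tau> t (u t)))"

definition evol_Cb ::
  "(real \<Rightarrow> real \<Rightarrow> 'a::banach \<Rightarrow>\<^sub>L 'a) \<Rightarrow> real \<Rightarrow> (real \<Rightarrow> 'a) set" where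
  "evol_Cb U \<alpha> = {u. continuous_on {0..} u \<and> bdd_above ((\<lambda>t. evol_phi U \<alpha> t u) ` {0..})}"

definition evol_Phi ::
  "(real \<Rightarrow> real \<Rightarrow> 'a::banach \<Rightarrow>\<^sub>L 'a) \<Rightarrow> real \<Rightarrow> (real \<Rightarrow> 'a) \<Rightarrow> real \<Rightarrow> 'a" where
  "evol_Phi U t u = (\<lambda>\<xi>. if \<xi> \<ge> t then U \<xi> t (u t) else u \<xi>)"

end

theory Submission
  imports Defs
begin

text \<open>
  For an admissible \<open>\<alpha> \<ge> 0\<close> the function \<open>h \<xi> = \<phi>\<^sub>\<alpha>(\<xi>, \<Phi>(t)u)\<^sup>p\<close> grows by at most a
  fixed factor on unit intervals, and its tails satisfy \<open>\<integral>\<^sub>s\<^sup>\<infinity> h \<le> K h(s)\<close>, by the hypothesis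
  applied at \<open>s\<close> to a function with value \<open>U(s,t)u(t)\<close> there. Integrating over \<open>[s - 1, s]\<close> bounds
  \<open>h(s)\<close> by \<open>C h(r)\<close> for all \<open>r \<le> s\<close>; integrating over \<open>[r, s]\<close> then gives
  \<open>(s - r) h(s) \<le> C K h(r)\<close>, so \<open>h\<close> halves over every interval of length \<open>2 C K\<close> and decays
  exponentially, with constants independent of \<open>t\<close> and \<open>u\<close>.
\<close>

text \<open>The tail integral dominates the integral over [a, b], where the integrand is at least
  \<open>c\<close>. This turns an integral bound into a pointwise inequality; it is used once with
  an interval of length 1 and once with one of length \<open>T\<close>.\<close>

lemma datko_tail_lower_bound:
  fixes h :: "real \<Rightarrow> real"
  assumes tail: "(\<integral>\<^sup>+\<xi>\<in>{r..}. ennreal (h \<xi>) \<partial>lborel) \<le> ennreal (K * h r)"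
    and "0 \<le> K" "0 \<le> h r" "0 \<le> c" "r \<le> a" "a \<le> b"
    and lower: "\<And>\<xi>. a \<le> \<xi> \<Longrightarrow> \<xi> \<le> b \<Longrightarrow> c \<le> h \<xi>"
  shows "c * (b - a) \<le> K * h r"
proof -
  have "ennreal (c * (b - a)) = (\<integral>\<^sup>+\<xi>\<in>{a..b}. ennreal c \<partial>lborel)"
    using assms by (simp add: nn_integral_cmult_indicator ennreal_mult)
  also have "\<dots> \<le> (\<integral>\<^sup>+\<xi>\<in>{r..}. ennreal (h \<xi>) \<partial>lborel)"
    using \<open>r \<le> a\<close> lower by (intro nn_integral_mono) (auto simp: indicator_def intro!: ennreal_leI)
  also note tail
  finally show ?thesis
    using assms by (simp add: ennreal_le_iff)
qed

lemma datko_decay: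
  fixes h :: "real \<Rightarrow> real" and B K :: real
  defines "C \<equiv> B * max 1 K"
  assumes B: "1 \<le> B" and K: "0 < K"
    and nonneg: "\<And>s. t \<le> s \<Longrightarrow> 0 \<le> h s"
    and growth: "\<And>r s. t \<le> r \<Longrightarrow> r \<le> s \<Longrightarrow> s \<le> r + 1 \<Longrightarrow> h s \<le> B * h r"
    and tail: "\<And>s. t \<le> s \<Longrightarrow> (\<integral>\<^sup>+\<xi>\<in>{s..}. ennreal (h \<xi>) \<partial>lborel) \<le> ennreal (K * h s)"
    and "t \<le> s"
  shows "h s \<le> 2 * C * exp (- (ln 2 / (2 * C * K)) * (s - t)) * h t"
proof -
  \<comment> \<open>\<open>C\<close> serves both cases of \<open>bounded\<close>: gaps of length at
    most 1 cost a factor \<open>B\<close>, longer ones a factor \<open>B * K\<close>.\<close>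
  have C: "1 \<le> C" "B \<le> C" "B * K \<le> C"
    using B K mult_mono[of 1 B 1 "max 1 K"] mult_left_mono[of 1 "max 1 K" B]
      mult_left_mono[of K "max 1 K" B] by (auto simp: C_def)
  have bounded: "h s \<le> C * h r" if "t \<le> r" "r \<le> s" for r s
  proof (cases "s \<le> r + 1")
    case True
    have "h s \<le> B * h r" using growth that True by blast
    also have "\<dots> \<le> C * h r" using C nonneg that by (intro mult_right_mono) auto
    finally show ?thesis .
  next
    case False
    \<comment> \<open>The window [s - 1, s] lies to the right of \<open>r\<close>, and unit growth
      keeps \<open>h\<close> at least \<open>h s / B\<close> on it.\<close>
    have "h s / B * (s - (s - 1)) \<le> K * h r"
    proof (rule datko_tail_lower_bound[OF tail[OF that(1)]])
      fix \<xi> assume "s - 1 \<le> \<xi>" "\<xi> \<le> s"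
      then have "h s \<le> B * h \<xi>" using growth[of \<xi> s] that False by auto
      then show "h s / B \<le> h \<xi>" using B by (simp add: field_simps)
    qed (use that nonneg B K False in auto)
    then have "h s \<le> B * K * h r" using B by (simp add: field_simps)
    also have "\<dots> \<le> C * h r" using C nonneg that by (intro mult_right_mono) auto
    finally show ?thesis .
  qed
  \<comment> \<open>This length makes the lower bound \<open>h (r + T) / C * T\<close> equal to
    \<open>2 * K * h (r + T)\<close>, so comparison with \<open>K * h r\<close> yields the factor
    1/2.\<close>
  define T where "T = 2 * C * K"
  have T: "0 < T" using C K by (simp add: T_def)
  have halving: "h (r + T) \<le> h r / 2" if "t \<le> r" for r
  proof -
    have "h (r + T) / C * ((r + T) - r) \<le> K * h r"
    proof (rule datko_tail_lower_bound[OF tail[OF that]])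
      fix \<xi> assume "r \<le> \<xi>" "\<xi> \<le> r + T"
      then have "h (r + T) \<le> C * h \<xi>" using bounded that by auto
      then show "h (r + T) / C \<le> h \<xi>" using C by (simp add: field_simps)
    qed (use that nonneg C K T in auto)
    then have "K * (2 * h (r + T)) \<le> K * h r" using C by (simp add: T_def field_simps)
    then show ?thesis using K by simp
  qed
  have iterate: "h (t + real n * T) \<le> h t / 2 ^ n" for n
  proof (induction n)
    case (Suc n)
    have "h (t + real n * T + T) \<le> h (t + real n * T) / 2"
      using T by (intro halving) simp
    then show ?case using Suc by (simp add: algebra_simps)
  qed simp
  \<comment> \<open>The number of whole periods \<open>T\<close> in [t, s]. The remainder costs a
    factor \<open>C\<close>; rounding down loses less than one halving, which is the factor 2 in the
    final constant.\<close>
  define n where "n = nat \<lfloor>(s - t) / T\<rfloor>"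
  have "0 \<le> (s - t) / T" using T \<open>t \<le> s\<close> by simp
  then have n: "real n \<le> (s - t) / T" "(s - t) / T - 1 \<le> real n"
    unfolding n_def by linarith+
  have "h s \<le> C * h (t + real n * T)"
    using n T by (intro bounded) (auto simp: field_simps)
  also have "\<dots> \<le> C * (h t / 2 ^ n)"
    using iterate C by (intro mult_left_mono) auto
  also have "\<dots> = C * exp (- (ln 2 * real n)) * h t"
    by (simp add: exp_minus mult.commute[of "ln 2"] exp_of_nat_mult divide_inverse)
  also have "\<dots> \<le> C * exp (ln 2 - ln 2 / T * (s - t)) * h t"
    using n(2) C nonneg[of t] mult_left_mono[OF n(2), of "ln 2"]
    by (intro mult_right_mono mult_left_mono) (auto simp: algebra_simps)
  also have "\<dots> = 2 * C * exp (- (ln 2 / T) * (s - t)) * h t"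
    by (simp add: exp_diff exp_minus field_simps)
  finally show ?thesis unfolding T_def .
qed

lemma evol_phi_cong: "u t = v t \<Longrightarrow> evol_phi U \<alpha> t u = evol_phi U \<alpha> t v"
  by (simp add: evol_phi_def)

text \<open>The weight cancels the exponential in the admissibility bound, so the supremum is finite
  and at most \<open>M * norm (u t)\<close>. The term \<tau> = t gives the lower bound.\<close>

lemma evol_phi_bounds:
  assumes "evolution_family U" "0 \<le> t"
    and M: "\<And>\<tau>. t \<le> \<tau> \<Longrightarrow> norm (U \<tau> t) \<le> M * exp (\<alpha> * (\<tau> - t))"
  shows evol_phi_bdd_above:
      "bdd_above ((\<lambda>\<tau>. exp (- \<alpha> * (\<tau> - t)) * norm (U \<tau> t (u t))) ` {t..})"
    and norm_le_evol_phi: "norm (u t) \<le> evol_phi U \<alpha> t u"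
    and evol_phi_le: "evol_phi U \<alpha> t u \<le> M * norm (u t)"
proof -
  have le: "exp (- \<alpha> * (\<tau> - t)) * norm (U \<tau> t (u t)) \<le> M * norm (u t)" if "t \<le> \<tau>" for \<tau>
  proof -
    have "norm (U \<tau> t (u t)) \<le> M * exp (\<alpha> * (\<tau> - t)) * norm (u t)"
      by (rule order_trans[OF norm_blinfun mult_right_mono[OF M[OF that]]]) simp
    then show ?thesis by (simp add: exp_minus divide_simps mult_ac)
  qed
  then show bdd: "bdd_above ((\<lambda>\<tau>. exp (- \<alpha> * (\<tau> - t)) * norm (U \<tau> t (u t))) ` {t..})"
    by (auto intro!: bdd_aboveI2)
  have "U t t = id_blinfun"
    using assms by (simp add: evolution_family_def)
  then show "norm (u t) \<le> evol_phi U \<alpha> t u"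
    unfolding evol_phi_def by (intro cSUP_upper2[OF bdd, of t]) auto
  show "evol_phi U \<alpha> t u \<le> M * norm (u t)"
    unfolding evol_phi_def using le by (intro cSUP_least) auto
qed

text \<open>By the cocycle law both suprema run over the same orbit. Moving the base point of the
  weight from \<open>t\<close> to \<open>s\<close> contributes the exponential factor, and \<tau>
  \<ge> s is a smaller range than \<tau> \<ge> t.\<close>

lemma evol_phi_growth:
  assumes U: "evolution_family U" and "0 \<le> t" "t \<le> s"
    and M: "\<And>\<tau>. t \<le> \<tau> \<Longrightarrow> norm (U \<tau> t) \<le> M * exp (\<alpha> * (\<tau> - t))"
  shows "evol_phi U \<alpha> s (evol_Phi U t u) \<le> exp (\<alpha> * (s - t)) * evol_phi U \<alpha> t u"
proof -
  have "exp (- \<alpha> * (\<tau> - s)) * norm (U \<tau> s (U s t (u t)))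
          \<le> exp (\<alpha> * (s - t)) * evol_phi U \<alpha> t u" if "s \<le> \<tau>" for \<tau>
  proof -
    have "U \<tau> s o\<^sub>L U s t = U \<tau> t"
      using U assms that by (simp add: evolution_family_def)
    then have "U \<tau> s (U s t (u t)) = U \<tau> t (u t)"
      by (metis blinfun_apply_blinfun_compose)
    moreover have "exp (- \<alpha> * (\<tau> - s)) = exp (\<alpha> * (s - t)) * exp (- \<alpha> * (\<tau> - t))"
      by (simp add: algebra_simps flip: exp_add)
    moreover have "exp (- \<alpha> * (\<tau> - t)) * norm (U \<tau> t (u t)) \<le> evol_phi U \<alpha> t u"
      unfolding evol_phi_def using that assms(2,3)
      by (intro cSUP_upper evol_phi_bdd_above[OF U \<open>0 \<le> t\<close> M]) auto
    ultimately show ?thesis by (simp add: mult.assoc)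
  qed
  then show ?thesis
    using \<open>t \<le> s\<close> unfolding evol_phi_def[of U \<alpha> s] by (intro cSUP_least) (auto simp: evol_Phi_def)
qed

lemma evol_Phi_restart:
  assumes "evolution_family U" "0 \<le> t" "t \<le> r" "r \<le> s"
  shows "evol_Phi U r (evol_Phi U t u) s = evol_Phi U t u s"
proof -
  have "U s r o\<^sub>L U r t = U s t"
    using assms by (simp add: evolution_family_def)
  then have "U s r (U r t (u t)) = U s t (u t)"
    by (metis blinfun_apply_blinfun_compose)
  then show ?thesis using assms by (simp add: evol_Phi_def)
qed

text \<open>Scaling a fixed vector by \<open>1 / M s\<close> offsets the nonuniform bound:
  \<open>evol_phi\<close> stays below the constant \<open>M t * norm x\<close>. Thus the integral
  hypothesis can be tested on any prescribed value at any time.\<close>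

lemma evol_Cb_interpolate:
  assumes "evolution_family U" "\<alpha> \<in> admissible_exponents U" "0 \<le> t"
  shows "\<exists>u\<in>evol_Cb U \<alpha>. u t = x"
proof -
  obtain M where cont: "continuous_on {0..} M" and pos: "\<And>s. 0 \<le> s \<Longrightarrow> 0 < M s"
    and M: "\<And>t s. 0 \<le> s \<Longrightarrow> s \<le> t \<Longrightarrow> norm (U t s) \<le> M s * exp (\<alpha> * (t - s))"
    using assms(2) unfolding admissible_exponents_def by blast
  define u where "u s = (M t / M s) *\<^sub>R x" for s
  have "M s * norm (u s) = M t * norm x" if "0 \<le> s" for s
    using pos[OF that] pos[OF \<open>0 \<le> t\<close>] by (simp add: u_def)
  then have "evol_phi U \<alpha> s u \<le> M t * norm x" if "0 \<le> s" for s
    using evol_phi_le[OF assms(1) that M[OF that], of u] that by auto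
  moreover have "continuous_on {0..} u"
    unfolding u_def using pos by (intro continuous_intros cont) (auto simp: less_imp_neq[THEN not_sym])
  ultimately have "u \<in> evol_Cb U \<alpha>"
    unfolding evol_Cb_def by (auto intro!: bdd_aboveI2)
  moreover have "u t = x" using pos[OF \<open>0 \<le> t\<close>] by (simp add: u_def)
  ultimately show ?thesis by blast
qed

theorem theorem3p7:
  fixes U :: "real \<Rightarrow> real \<Rightarrow> 'a::banach \<Rightarrow>\<^sub>L 'a"
  assumes "evolution_family U"
    and "nonuniform_exp_bounded U"
    and "\<exists>\<alpha>\<in>admissible_exponents U. \<exists>p>0. \<exists>K>0.
           \<forall>t\<ge>0. \<forall>u\<in>evol_Cb U \<alpha>.
             (\<integral>\<^sup>+\<xi>\<in>{t..}. ennreal (evol_phi U \<alpha> \<xi> (evol_Phi U t u) powr p) \<partial>lborel)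
               \<le> ennreal (K * evol_phi U \<alpha> t u powr p)"
  shows "nonuniform_exp_stable U"
proof -
  obtain \<alpha> p K where \<alpha>: "\<alpha> \<in> admissible_exponents U" and p: "0 < p" and K: "0 < K"
    and int: "\<And>t u. 0 \<le> t \<Longrightarrow> u \<in> evol_Cb U \<alpha> \<Longrightarrow>
             (\<integral>\<^sup>+\<xi>\<in>{t..}. ennreal (evol_phi U \<alpha> \<xi> (evol_Phi U t u) powr p) \<partial>lborel)
               \<le> ennreal (K * evol_phi U \<alpha> t u powr p)"
    using assms(3) by blast
  obtain M where cont: "continuous_on {0..} M" and pos: "\<And>s. 0 \<le> s \<Longrightarrow> 0 < M s"
    and M: "\<And>t s. 0 \<le> s \<Longrightarrow> s \<le> t \<Longrightarrow> norm (U t s) \<le> M s * exp (\<alpha> * (t - s))"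
    using \<alpha> unfolding admissible_exponents_def by blast
  show ?thesis
  proof (cases "\<alpha> < 0")
    case True
    then show ?thesis using \<alpha> unfolding nonuniform_exp_stable_def by blast
  next
    case False
    \<comment> \<open>Since \<alpha> \<ge> 0 here, this bounds the growth of the p-th power over any
      interval of length at most 1.\<close>
    define B where "B = exp (\<alpha> * p)"
    define C where "C = B * max 1 K"
    define \<nu> where "\<nu> = ln 2 / (2 * C * K)"
    have B: "1 \<le> B" using False p by (simp add: B_def)
    have C: "1 \<le> C" using B mult_mono[of 1 B 1 "max 1 K"] by (simp add: C_def)
    have \<nu>: "0 < \<nu>" using C K by (simp add: \<nu>_def)
    have decay: "norm (U s t x) \<le> (2 * C) powr (1 / p) * exp (- (\<nu> / p) * (s - t)) * (M t * norm x)"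
      if t: "0 \<le> t" and s: "t \<le> s" for t s x
    proof -
      \<comment> \<open>From time \<open>t\<close> on, \<open>v\<close> is the orbit of
        \<open>x\<close>; its earlier values do not enter the estimates.\<close>
      define v where "v = evol_Phi U t (\<lambda>_. x)"
      have v: "v t = x"
        using assms(1) t by (simp add: v_def evol_Phi_def evolution_family_def)
      have nonneg: "0 \<le> evol_phi U \<alpha> r v" if "t \<le> r" for r
        using t that by (intro order_trans[OF norm_ge_zero norm_le_evol_phi[OF assms(1) _ M]]) auto
      have restart: "evol_phi U \<alpha> r (evol_Phi U q v) = evol_phi U \<alpha> r v" if "t \<le> q" "q \<le> r" for q r
        unfolding v_def using evol_Phi_restart[OF assms(1) t that] by (intro evol_phi_cong)
      have "evol_phi U \<alpha> s v powr p
              \<le> 2 * C * exp (- \<nu> * (s - t)) * evol_phi U \<alpha> t v powr p"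
        unfolding C_def \<nu>_def
      proof (rule datko_decay[OF B K _ _ _ s])
        fix q r assume qr: "t \<le> q" "q \<le> r" "r \<le> q + 1"
        have "evol_phi U \<alpha> r v \<le> exp (\<alpha> * (r - q)) * evol_phi U \<alpha> q v"
          using evol_phi_growth[OF assms(1) _ qr(2) M, of v] restart qr t by auto
        also have "\<dots> \<le> exp \<alpha> * evol_phi U \<alpha> q v"
          using False nonneg qr mult_left_mono[of "r - q" 1 \<alpha>] by (intro mult_right_mono) auto
        finally have "evol_phi U \<alpha> r v powr p \<le> (exp \<alpha> * evol_phi U \<alpha> q v) powr p"
          using p nonneg qr by (intro powr_mono2) auto
        then show "evol_phi U \<alpha> r v powr p \<le> B * evol_phi U \<alpha> q v powr p"
          using nonneg qr by (simp add: powr_mult B_def exp_powr_real)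
      next
        fix r assume r: "t \<le> r"
        \<comment> \<open>The hypothesis speaks of members of \<open>evol_Cb\<close>, so it is
          applied to such a \<open>u\<close> through the orbit point \<open>v r\<close>. From
          \<open>r\<close> on, the restarted \<open>u\<close> coincides with the orbit, hence so do
          the integrands.\<close>
        with t obtain u where u: "u \<in> evol_Cb U \<alpha>" "u r = v r"
          using evol_Cb_interpolate[OF assms(1) \<alpha>, of r "v r"] by auto
        have "evol_phi U \<alpha> \<xi> (evol_Phi U r u) = evol_phi U \<alpha> \<xi> v" if "r \<le> \<xi>" for \<xi>
          using restart[OF r that] that u(2)
            evol_phi_cong[of "evol_Phi U r u" \<xi> "evol_Phi U r v" U \<alpha>] by (simp add: evol_Phi_def)
        then have "(\<integral>\<^sup>+\<xi>\<in>{r..}. ennreal (evol_phi U \<alpha> \<xi> v powr p) \<partial>lborel)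
            = (\<integral>\<^sup>+\<xi>\<in>{r..}. ennreal (evol_phi U \<alpha> \<xi> (evol_Phi U r u) powr p) \<partial>lborel)"
          by (intro nn_integral_cong) (auto simp: indicator_def)
        also have "\<dots> \<le> ennreal (K * evol_phi U \<alpha> r v powr p)"
          using int[OF _ u(1), of r] r t evol_phi_cong[of u r v U \<alpha>] u(2) by simp
        finally show "(\<integral>\<^sup>+\<xi>\<in>{r..}. ennreal (evol_phi U \<alpha> \<xi> v powr p) \<partial>lborel)
            \<le> ennreal (K * evol_phi U \<alpha> r v powr p)" .
      qed simp
      \<comment> \<open>Taking p-th roots divides the rate by \<open>p\<close>.\<close>
      then have "(evol_phi U \<alpha> s v powr p) powr (1 / p)
              \<le> (2 * C * exp (- \<nu> * (s - t)) * evol_phi U \<alpha> t v powr p) powr (1 / p)"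
        using p by (intro powr_mono2) auto
      then have "evol_phi U \<alpha> s v
              \<le> (2 * C) powr (1 / p) * exp (- (\<nu> / p) * (s - t)) * evol_phi U \<alpha> t v"
        using p C nonneg[OF s] nonneg[of t] by (simp add: powr_mult powr_powr exp_powr_real)
      also have "\<dots> \<le> (2 * C) powr (1 / p) * exp (- (\<nu> / p) * (s - t)) * (M t * norm x)"
        using evol_phi_le[OF assms(1) t M[OF t], of v] v by (intro mult_left_mono) auto
      finally show ?thesis
        using norm_le_evol_phi[OF assms(1) _ M, of s v] s t by (simp add: v_def evol_Phi_def)
    qed
    \<comment> \<open>The starting time enters only through \<open>M\<close>, so the new bound is a
      constant multiple of \<open>M\<close> and inherits its continuity and positivity.\<close>
    define N where "N t = (2 * C) powr (1 / p) * M t" for t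
    have "norm (U t s) \<le> N s * exp (- (\<nu> / p) * (t - s))" if "0 \<le> s" "s \<le> t" for t s
      using decay[OF that] pos[OF that(1)] by (intro norm_blinfun_bound) (auto simp: N_def mult_ac)
    moreover have "continuous_on {0..} N" "\<forall>s\<ge>0. 0 < N s"
      unfolding N_def using pos C by (auto intro!: continuous_intros cont mult_pos_pos)
    ultimately have "- (\<nu> / p) \<in> admissible_exponents U"
      unfolding admissible_exponents_def by blast
    then show ?thesis
      using \<nu> p unfolding nonuniform_exp_stable_def by (intro bexI[of _ "- (\<nu> / p)"]) simp_all
  qed
qed

end
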